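(* Let $J_1,J_2:(0,1)\to\mathbb{R}$ be square-integrable score functions that are monotone increasing, skew-symmetric about $1/2$, and differentiable, with $J_1'(1/2)>0$ and $J_2'(1/2)>0$. Let $f\in\mathcal{F}_2\cap\mathcal{F}_{J_1}\cap\mathcal{F}_{J_2}$ be a symmetric probability density. (i) If $J_1$ and $J_2$ are convex on $[1/2,1)$, then $$\mathrm{ARE}^*_f(\phi^r_{\rm SWW}/\phi^r_{J_1J_2})=\mathrm{ARE}^*_f(\phi^r_{\rm K}/\phi^r_{J_1J_2})\le 144\,\frac{\mathcal{K}(J_1)\,\mathcal{K}(J_2)}{\big(J_1'(1/2)\,J_2'(1/2)\big)^2}.$$ (ii) If $J_1$ and $J_2$ are concave on $[1/2,1)$, then $$\mathrm{ARE}^*_f(\phi^r_{J_1J_2}/\phi^r_{\rm SWW})=\mathrm{ARE}^*_f(\phi^r_{J_1J_2}/\phi^r_{\rm K})\le \frac{1}{144}\,\frac{\big(J_1'(1/2)\,J_2'(1/2)\big)^2}{\mathcal{K}(J_1)\,\mathcal{K}(J_2)}.$$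
   Context: $\mathcal{F}$ is the class of probability densities $f$ on $\mathbb{R}$ (with distribution function $F$ and quantile function $F^{-1}$) that admit a weak derivative $f'$ and are such that, with $\varphi_f:=-f'/f$, the Fisher information for location $\mathcal{I}(f)=\int_0^1\varphi_f^2(F^{-1}(u))\,du$ is finite. (One may take $f$ absolutely continuous with a.e. derivative $f'$.) $\mathcal{F}_2$ is the set of $f\in\mathcal{F}$ with finite second-order moment. Let $\mathcal{F}_0:=\{f\in\mathcal{F}:\lim_{x\to\pm\infty}f(x)=0\}$ and, for a differentiable score function $J$ on $(0,1)$, $\mathcal{F}_J:=\{f\in\mathcal{F}_0:\lim_{x\to\pm\infty}J(F(x))f(x)=0\}$. A density is symmetric if $f(-x)=f(x)$; a score function $J$ is skew-symmetric about $1/2$ if $J(1-u)=-J(u)$ for $u\in(0,1)$. For a square-integrable score function $J$ on $(0,1)$, let $\mathcal{K}(J):=\int_0^1J^2(u)\,du$, $\mathcal{K}(J,f):=\int_0^1J(u)\varphi_f(F^{-1}(u))\,du$ and $\mathcal{J}(J,f):=\int_0^1J(u)F^{-1}(u)\,du$. For score functions $J,\tilde J$, $\phi^r_{J\tilde J}$ denotes the test of serial dependence (against ARMA alternatives) based on the lag-$k$ rank autocorrelation, i.e. the standardized version of $(n-k)^{-1}\sum_{t=k+1}^nJ\big(\tfrac{R_t}{n+1}\big)\tilde J\big(\tfrac{R_{t-k}}{n+1}\big)$, where $R_1,\dots,R_n$ are the ranks of the observations. The asymptotic relative efficiency of $\phi^r_{J_1J_2}$ with respect to $\phi^r_{J_3J_4}$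 under innovation density $f\in\mathcal{F}_2$ is $$\mathrm{ARE}^*_f(\phi^r_{J_1J_2}/\phi^r_{J_3J_4})=\frac{\mathcal{K}(J_3)}{\mathcal{K}(J_1)}\left(\frac{\mathcal{K}(J_1,f)}{\mathcal{K}(J_3,f)}\right)^2\frac{\mathcal{K}(J_4)}{\mathcal{K}(J_2)}\left(\frac{\mathcal{J}(J_2,f)}{\mathcal{J}(J_4,f)}\right)^2 .$$ $\phi^r_{\rm SWW}$ is the Spearman-Wald-Wolfowitz test, i.e. $\phi^r_{J_{\rm W}J_{\rm W}}$ with $J_{\rm W}(u)=u-1/2$. $\phi^r_{\rm K}$ is the test based on Kendall rank autocorrelations (the standardized version of $1-4D_k/((n-k)(n-k-1))$, with $D_k$ the number of discordances at lag $k$). Kendall autocorrelations are asymptotically equivalent to the Spearman-Wald-Wolfowitz ones under the null hypothesis of independence, and accordingly the AREs of $\phi^r_{\rm K}$ are computed with the same scores $J_{\rm W},J_{\rm W}$ as for $\phi^r_{\rm SWW}$, i.e. $$\mathrm{ARE}^*_f(\phi^r_{\rm K}/\phi^r_{J_1J_2})=\frac{\mathcal{K}(J_1)}{\mathcal{K}(J_{\rm W})}\left(\frac{\mathcal{K}(J_{\rm W},f)}{\mathcal{K}(J_1,f)}\right)^2\frac{\mathcal{K}(J_2)}{\mathcal{K}(J_{\rm W})}\left(\frac{\mathcal{J}(J_{\rm W},f)}{\mathcal{J}(J_2,f)}\right)^2,$$ and $\mathrm{ARE}^*_f(\phi^r_{J_1J_2}/\phi^r_{\rm K})=1/\mathrm{ARE}^*_f(\phi^r_{\rm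 K}/\phi^r_{J_1J_2})$. *)

theory Defs
  imports "HOL-Probability.Probability"
begin

definition prob_density :: "(real \<Rightarrow> real) \<Rightarrow> bool" where
  "prob_density f \<longleftrightarrow> (\<forall>x. 0 \<le> f x) \<and> has_bochner_integral lborel f 1"

definition dist_fun :: "(real \<Rightarrow> real) \<Rightarrow> real \<Rightarrow> real" where
  "dist_fun f = cdf (density lborel (\<lambda>x. ennreal (f x)))"

text \<open>The quantile function, the left-continuous inverse of the distribution function; it is
  only meaningful (and only used) on \<open>(0,1)\<close>.\<close>

definition quantile_fun :: "(real \<Rightarrow> real) \<Rightarrow> real \<Rightarrow> real" where
  "quantile_fun f u = Inf {x. u \<le> dist_fun f x}"

text \<open>The usual \<open>\<epsilon>\<close>-\<open>\<delta>\<close> definition of absolute continuity on a compact interval. The members of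
  \<open>\<D>\<close> are closed intervals with disjoint interiors, with endpoints \<open>Inf K\<close> and \<open>Sup K\<close>.\<close>

definition abs_continuous_on_interval :: "real \<Rightarrow> real \<Rightarrow> (real \<Rightarrow> real) \<Rightarrow> bool" where
  "abs_continuous_on_interval a b f \<longleftrightarrow>
     (\<forall>\<epsilon>>0. \<exists>\<delta>>0. \<forall>\<D> T. \<D> division_of T \<and> T \<subseteq> {a..b} \<and> (\<Sum>K\<in>\<D>. Sup K - Inf K) < \<delta> \<longrightarrow>
        (\<Sum>K\<in>\<D>. \<bar>f (Sup K) - f (Inf K)\<bar>) < \<epsilon>)"

text \<open>A density with a weak derivative is represented by its (locally) absolutely continuous
  version, and the weak derivative by the almost everywhere derivative \<open>deriv f\<close>. By Lebesgue's
  theorem the second conjunct is a consequence of the first; it is spelled out because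
  \<open>deriv f x\<close> carries no information at points where \<open>f\<close> is not differentiable.\<close>

definition abs_continuous_with_deriv :: "(real \<Rightarrow> real) \<Rightarrow> bool" where
  "abs_continuous_with_deriv f \<longleftrightarrow>
     (\<forall>a b. abs_continuous_on_interval a b f) \<and>
     (AE x in lborel. (f has_real_derivative deriv f x) (at x))"

text \<open>Where \<open>f\<close> vanishes, \<open>loc_score f\<close> is \<open>0\<close> by the convention for division by zero. This
  is immaterial below: \<open>quantile_fun f u\<close> lies in \<open>{x. f x > 0}\<close> for almost every \<open>u\<close> in \<open>(0,1)\<close>.\<close>

definition loc_score :: "(real \<Rightarrow> real) \<Rightarrow> real \<Rightarrow> real" where
  "loc_score f x = - deriv f x / f x"

definition finite_fisher_info :: "(real \<Rightarrow> real) \<Rightarrow> bool" where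
  "finite_fisher_info f \<longleftrightarrow>
     set_integrable lborel {0<..<1} (\<lambda>u. (loc_score f (quantile_fun f u))\<^sup>2)"

definition class_F :: "(real \<Rightarrow> real) set" where
  "class_F = {f. prob_density f \<and> abs_continuous_with_deriv f \<and> finite_fisher_info f}"

definition class_F2 :: "(real \<Rightarrow> real) set" where
  "class_F2 = {f \<in> class_F. integrable lborel (\<lambda>x. x\<^sup>2 * f x)}"

definition class_F0 :: "(real \<Rightarrow> real) set" where
  "class_F0 = {f \<in> class_F. (f \<longlongrightarrow> 0) at_top \<and> (f \<longlongrightarrow> 0) at_bot}"

text \<open>A score function lives on \<open>(0,1)\<close>. If the distribution function attains \<open>0\<close> or \<open>1\<close>, then \<open>f\<close>
  vanishes there, so the value of \<open>J\<close> outside \<open>(0,1)\<close> does not influence the product.\<close>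

definition class_FJ :: "(real \<Rightarrow> real) \<Rightarrow> (real \<Rightarrow> real) set" where
  "class_FJ J = {f \<in> class_F0.
     ((\<lambda>x. J (dist_fun f x) * f x) \<longlongrightarrow> 0) at_top \<and>
     ((\<lambda>x. J (dist_fun f x) * f x) \<longlongrightarrow> 0) at_bot}"

definition symmetric_density :: "(real \<Rightarrow> real) \<Rightarrow> bool" where
  "symmetric_density f \<longleftrightarrow> (\<forall>x. f (- x) = f x)"

definition skew_symmetric_score :: "(real \<Rightarrow> real) \<Rightarrow> bool" where
  "skew_symmetric_score J \<longleftrightarrow> (\<forall>u\<in>{0<..<1}. J (1 - u) = - J u)"

definition square_integrable_score :: "(real \<Rightarrow> real) \<Rightarrow> bool" where
  "square_integrable_score J \<longleftrightarrow>
     set_borel_measurable lborel {0<..<1} J \<and> set_integrable lborel {0<..<1} (\<lambda>u. (J u)\<^sup>2)"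

text \<open>\<open>\<K>(J)\<close>, \<open>\<K>(J,f)\<close> and \<open>\<J>(J,f)\<close>.\<close>

definition K_score :: "(real \<Rightarrow> real) \<Rightarrow> real" where
  "K_score J = (LBINT u:{0<..<1}. (J u)\<^sup>2)"

definition K_cross :: "(real \<Rightarrow> real) \<Rightarrow> (real \<Rightarrow> real) \<Rightarrow> real" where
  "K_cross J f = (LBINT u:{0<..<1}. J u * loc_score f (quantile_fun f u))"

definition J_cross :: "(real \<Rightarrow> real) \<Rightarrow> (real \<Rightarrow> real) \<Rightarrow> real" where
  "J_cross J f = (LBINT u:{0<..<1}. J u * quantile_fun f u)"

text \<open>\<open>ARE_rank f J1 J2 J3 J4\<close> is the asymptotic relative efficiency, under innovation density \<open>f\<close>,
  of the serial rank test with scores \<open>(J1, J2)\<close> with respect to the one with scores \<open>(J3, J4)\<close>.\<close>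

definition ARE_rank ::
  "(real \<Rightarrow> real) \<Rightarrow> (real \<Rightarrow> real) \<Rightarrow> (real \<Rightarrow> real) \<Rightarrow> (real \<Rightarrow> real) \<Rightarrow> (real \<Rightarrow> real) \<Rightarrow> real" where
  "ARE_rank f J1 J2 J3 J4 =
     K_score J3 / K_score J1 * (K_cross J1 f / K_cross J3 f)\<^sup>2 *
     (K_score J4 / K_score J2) * (J_cross J2 f / J_cross J4 f)\<^sup>2"

definition wilcoxon_score :: "real \<Rightarrow> real" where
  "wilcoxon_score u = u - 1 / 2"

text \<open>The Spearman-Wald-Wolfowitz (SWW) test is the serial rank test with Wilcoxon scores.\<close>

definition ARE_SWW_rank :: "(real \<Rightarrow> real) \<Rightarrow> (real \<Rightarrow> real) \<Rightarrow> (real \<Rightarrow> real) \<Rightarrow> real" where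
  "ARE_SWW_rank f J1 J2 = ARE_rank f wilcoxon_score wilcoxon_score J1 J2"

definition ARE_rank_SWW :: "(real \<Rightarrow> real) \<Rightarrow> (real \<Rightarrow> real) \<Rightarrow> (real \<Rightarrow> real) \<Rightarrow> real" where
  "ARE_rank_SWW f J1 J2 = ARE_rank f J1 J2 wilcoxon_score wilcoxon_score"

text \<open>The Kendall test is not itself of linear rank form. Its autocorrelations are asymptotically
  equivalent to the SWW ones under independence, so its efficiencies are by convention computed
  from the Wilcoxon scores.\<close>

definition ARE_Kendall_rank :: "(real \<Rightarrow> real) \<Rightarrow> (real \<Rightarrow> real) \<Rightarrow> (real \<Rightarrow> real) \<Rightarrow> real" where
  "ARE_Kendall_rank f J1 J2 =
     K_score J1 / K_score wilcoxon_score * (K_cross wilcoxon_score f / K_cross J1 f)\<^sup>2 *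
     (K_score J2 / K_score wilcoxon_score) * (J_cross wilcoxon_score f / J_cross J2 f)\<^sup>2"

definition ARE_rank_Kendall :: "(real \<Rightarrow> real) \<Rightarrow> (real \<Rightarrow> real) \<Rightarrow> (real \<Rightarrow> real) \<Rightarrow> real" where
  "ARE_rank_Kendall f J1 J2 = 1 / ARE_Kendall_rank f J1 J2"

end

theory Submission
  imports Defs
begin

text \<open>Each of \<open>\<K>(J, f)\<close> and \<open>\<J>(J, f)\<close> has the form \<open>\<integral> J \<psi>\<close> over \<open>(0,1)\<close>, with
  \<open>\<psi> = \<phi>\<^sub>f \<circ> F\<^sup>-\<^sup>1\<close> and \<open>\<psi> = F\<^sup>-\<^sup>1\<close> respectively. In both cases \<open>\<psi>\<close> has integral \<open>0\<close> and
  nonnegative integrals over all tails \<open>(t, 1)\<close>: for the location score the tail integral is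
  \<open>f (F\<^sup>-\<^sup>1 t)\<close>. By the layer cake formula, \<open>\<integral> G \<psi> \<ge> 0\<close> for every nondecreasing \<open>G\<close>. If \<open>J\<close> is
  skew-symmetric and convex on \<open>[1/2, 1)\<close>, then \<open>G = J - J'(1/2) J\<^sub>W\<close> is nondecreasing on \<open>(0, 1)\<close>, so
  \<open>\<integral> J \<psi> \<ge> J'(1/2) \<integral> J\<^sub>W \<psi> \<ge> 0\<close>; in the concave case \<open>-G\<close> is nondecreasing. This avoids integrating
  by parts against \<open>J \<circ> F\<close>. The constant is \<open>144 = 1 / \<K>(J\<^sub>W)\<^sup>2\<close>.\<close>

section \<open>Derivatives of absolutely continuous functions\<close>

text \<open>Differentiability at \<open>x\<close> is a Cauchy condition on difference quotients as
  the step tends to 0. Continuity of \<open>f\<close> reduces it to rational steps, so it is a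
  countable combination of Borel conditions. Where it holds, \<open>deriv f\<close> is the limit of
  a sequence of measurable functions; elsewhere it is constant.\<close>

lemma borel_measurable_deriv_continuous:
  fixes f :: "real \<Rightarrow> real"
  assumes cont: "continuous_on UNIV f"
  shows "deriv f \<in> borel_measurable borel"
proof -
  define \<Delta> where "\<Delta> x h = (f (x + h) - f x) / h" for x h
  have [measurable]: "f \<in> borel_measurable borel"
    using cont by (rule borel_measurable_continuous_onI)
  have [measurable]: "(\<lambda>x. \<Delta> x h) \<in> borel_measurable borel" for h
    unfolding \<Delta>_def by measurable
  have cont\<Delta>: "isCont (\<Delta> x) h" if "h \<noteq> 0" for x h
  proof -
    have "isCont f z" for z
      using cont by (simp add: continuous_on_eq_continuous_at)
    then have "isCont (\<lambda>h. f (x + h)) h"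
      by (intro isCont_o2[where f = "\<lambda>h. x + h" and g = f] continuous_intros)
    then show ?thesis
      unfolding \<Delta>_def using that by (intro continuous_intros) auto
  qed
  \<comment> \<open>Rational steps keep every quantifier countable, which makes
    \<open>cauchy\<close> a Borel predicate.\<close>
  define cauchy where "cauchy x \<longleftrightarrow> (\<forall>n::nat. \<exists>m::nat. \<forall>p\<in>\<rat>. \<forall>q\<in>\<rat>.
    0 < \<bar>p\<bar> \<and> \<bar>p\<bar> < 1 / Suc m \<and> 0 < \<bar>q\<bar> \<and> \<bar>q\<bar> < 1 / Suc m \<longrightarrow>
      \<bar>\<Delta> x p - \<Delta> x q\<bar> \<le> 1 / Suc n)" for x
  have lim0: "(\<lambda>k. \<Delta> x (1 / Suc k)) \<longlonglongrightarrow> l" if "(f has_real_derivative l) (at x)" for x l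
  proof -
    have "((\<Delta> x) \<longlongrightarrow> l) (at 0)"
      using that unfolding DERIV_def \<Delta>_def .
    moreover have "filterlim (\<lambda>k. 1 / real (Suc k)) (at 0) sequentially"
      using lim_1_over_real_power[of 1] LIMSEQ_Suc[OF lim_1_over_n[where 'a = real]]
      by (auto simp: filterlim_at)
    ultimately show ?thesis
      by (rule filterlim_compose)
  qed
  have diff: "cauchy x \<longleftrightarrow> (\<exists>l. (f has_real_derivative l) (at x))" for x
  proof
    assume "\<exists>l. (f has_real_derivative l) (at x)"
    then obtain l where l: "((\<Delta> x) \<longlongrightarrow> l) (at 0)"
      unfolding DERIV_def \<Delta>_def by blast
    show "cauchy x"
      unfolding cauchy_def
    proof
      fix n :: nat
      obtain d where d: "d > 0" "\<And>h. h \<noteq> 0 \<Longrightarrow> \<bar>h\<bar> < d \<Longrightarrow> \<bar>\<Delta> x h - l\<bar> < 1 / (2 * real (Suc n))"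
        using LIM_D[OF l, of "1 / (2 * real (Suc n))"] by auto
      obtain m where m: "1 / Suc m < d"
        using d(1) by (metis nat_approx_posE)
      have "\<bar>\<Delta> x p - \<Delta> x q\<bar> \<le> 1 / Suc n"
        if "0 < \<bar>p\<bar>" "\<bar>p\<bar> < 1 / Suc m" "0 < \<bar>q\<bar>" "\<bar>q\<bar> < 1 / Suc m" for p q
      proof -
        define c where "c = 1 / (2 * real (Suc n))"
        have "\<bar>\<Delta> x p - l\<bar> < c" "\<bar>\<Delta> x q - l\<bar> < c"
          using that m d(2)[of p] d(2)[of q] unfolding c_def by linarith+
        moreover have "1 / Suc n = c + c"
          by (simp add: c_def field_simps)
        ultimately show ?thesis by linarith
      qed
      then show "\<exists>m::nat. \<forall>p\<in>\<rat>. \<forall>q\<in>\<rat>.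
          0 < \<bar>p\<bar> \<and> \<bar>p\<bar> < 1 / Suc m \<and> 0 < \<bar>q\<bar> \<and> \<bar>q\<bar> < 1 / Suc m \<longrightarrow>
            \<bar>\<Delta> x p - \<Delta> x q\<bar> \<le> 1 / Suc n"
        by blast
    qed
  next
    assume c: "cauchy x"
    \<comment> \<open>The punctured neighbourhood \<open>V\<close> below is open, so each of its
      points is a limit of rationals in \<open>V\<close>. Since \<open>\<Delta> x\<close> is
      continuous there, the non-strict bound passes to the limit.\<close>
    have all: "\<exists>m::nat. \<forall>p q. 0 < \<bar>p\<bar> \<and> \<bar>p\<bar> < 1 / Suc m \<and> 0 < \<bar>q\<bar> \<and> \<bar>q\<bar> < 1 / Suc m \<longrightarrow>
      \<bar>\<Delta> x p - \<Delta> x q\<bar> \<le> 1 / Suc n" for n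
    proof -
      obtain m where m: "\<And>p q. \<lbrakk>p \<in> \<rat>; q \<in> \<rat>; 0 < \<bar>p\<bar>; \<bar>p\<bar> < 1 / Suc m; 0 < \<bar>q\<bar>; \<bar>q\<bar> < 1 / Suc m\<rbrakk>
        \<Longrightarrow> \<bar>\<Delta> x p - \<Delta> x q\<bar> \<le> 1 / Suc n"
        using c unfolding cauchy_def by meson
      define V where "V = {h. 0 < \<bar>h\<bar> \<and> \<bar>h\<bar> < 1 / Suc m}"
      have "V = {- (1 / Suc m)<..<1 / Suc m} - {0}"
        by (auto simp: V_def)
      then have "open V" by auto
      have approx: "\<exists>r. (\<forall>i. r i \<in> \<rat> \<inter> V) \<and> r \<longlonglongrightarrow> h" if "h \<in> V" for h
      proof -
        have "h \<in> closure (\<rat> \<inter> V)"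
          using open_Int_closure_subset[OF \<open>open V\<close>, of "\<rat>"] that
          by (auto simp: Rats_closure_real Int_commute)
        then show ?thesis by (simp add: closure_sequential)
      qed
      have "\<bar>\<Delta> x p - \<Delta> x q\<bar> \<le> 1 / Suc n" if pq: "p \<in> V" "q \<in> V" for p q
      proof -
        obtain r t where r: "\<And>i. r i \<in> \<rat> \<inter> V" "r \<longlonglongrightarrow> p" and t: "\<And>i. t i \<in> \<rat> \<inter> V" "t \<longlonglongrightarrow> q"
          using approx[OF pq(1)] approx[OF pq(2)] by blast
        have "(\<lambda>i. \<bar>\<Delta> x (r i) - \<Delta> x (t i)\<bar>) \<longlonglongrightarrow> \<bar>\<Delta> x p - \<Delta> x q\<bar>"
          using r t pq
          by (intro tendsto_intros isCont_tendsto_compose[OF cont\<Delta>]) (auto simp: V_def)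
        then show ?thesis
          by (rule Lim_bounded[where M = 0]) (use r t m in \<open>auto simp: V_def\<close>)
      qed
      then show ?thesis by (auto simp: V_def)
    qed
    have "Cauchy (\<lambda>k. \<Delta> x (1 / Suc k))"
      unfolding Cauchy_def dist_real_def
    proof (intro allI impI)
      fix e :: real assume "e > 0"
      then obtain n where n: "1 / Suc n < e"
        by (metis nat_approx_posE)
      obtain m where m: "\<And>p q. 0 < \<bar>p\<bar> \<and> \<bar>p\<bar> < 1 / Suc m \<and> 0 < \<bar>q\<bar> \<and> \<bar>q\<bar> < 1 / Suc m \<Longrightarrow>
        \<bar>\<Delta> x p - \<Delta> x q\<bar> \<le> 1 / Suc n"
        using all[of n] by blast
      \<comment> \<open>Starting at \<open>Suc m\<close> gives the strict inequality
        \<open>1 / Suc i < 1 / Suc m\<close>.\<close>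
      have "\<bar>\<Delta> x (1 / Suc i) - \<Delta> x (1 / Suc j)\<bar> < e" if "i \<ge> Suc m" "j \<ge> Suc m" for i j
        using m[of "1 / Suc i" "1 / Suc j"] n that
        by (force simp: frac_less2)
      then show "\<exists>N. \<forall>i\<ge>N. \<forall>j\<ge>N. \<bar>\<Delta> x (1 / Suc i) - \<Delta> x (1 / Suc j)\<bar> < e"
        by blast
    qed
    then obtain l where l: "(\<lambda>k. \<Delta> x (1 / Suc k)) \<longlonglongrightarrow> l"
      using Cauchy_convergent convergent_def by blast
    have "((\<Delta> x) \<longlongrightarrow> l) (at 0)"
    proof (rule LIM_I)
      fix e :: real assume "e > 0"
      then obtain n where n: "1 / Suc n < e"
        by (metis nat_approx_posE)
      obtain m where m: "\<And>p q. 0 < \<bar>p\<bar> \<and> \<bar>p\<bar> < 1 / Suc m \<and> 0 < \<bar>q\<bar> \<and> \<bar>q\<bar> < 1 / Suc m \<Longrightarrow>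
        \<bar>\<Delta> x p - \<Delta> x q\<bar> \<le> 1 / Suc n"
        using all[of n] by blast
      \<comment> \<open>With \<open>p\<close> fixed, the second step runs through
        \<open>1 / Suc k\<close>, so the Cauchy bound becomes a bound on the distance to
        \<open>l\<close>.\<close>
      have "\<bar>\<Delta> x p - l\<bar> \<le> 1 / Suc n" if p: "0 < \<bar>p\<bar>" "\<bar>p\<bar> < 1 / Suc m" for p
      proof (rule Lim_bounded[where M = "Suc m"])
        show "(\<lambda>k. \<bar>\<Delta> x p - \<Delta> x (1 / Suc k)\<bar>) \<longlonglongrightarrow> \<bar>\<Delta> x p - l\<bar>"
          by (intro tendsto_intros l)
        show "\<forall>k\<ge>Suc m. \<bar>\<Delta> x p - \<Delta> x (1 / Suc k)\<bar> \<le> 1 / Suc n"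
        proof (intro allI impI)
          fix k assume "Suc m \<le> k"
          then show "\<bar>\<Delta> x p - \<Delta> x (1 / Suc k)\<bar> \<le> 1 / Suc n"
            using p by (intro m) (auto simp: frac_less2)
        qed
      qed
      then have "\<forall>h. h \<noteq> 0 \<and> norm (h - 0) < 1 / Suc m \<longrightarrow> norm (\<Delta> x h - l) < e"
        using n by fastforce
      then show "\<exists>s>0. \<forall>h. h \<noteq> 0 \<and> norm (h - 0) < s \<longrightarrow> norm (\<Delta> x h - l) < e"
        by (intro exI[of _ "1 / Suc m"]) auto
    qed
    then show "\<exists>l. (f has_real_derivative l) (at x)"
      unfolding DERIV_def \<Delta>_def by blast
  qed
  \<comment> \<open>\<open>SOME D. False\<close> is the junk value of \<open>deriv f\<close> where \<open>f\<close> is not differentiable.\<close>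
  have "deriv f = (\<lambda>x. if cauchy x then lim (\<lambda>k. \<Delta> x (1 / Suc k)) else (SOME D. False))"
  proof
    fix x
    show "deriv f x = (if cauchy x then lim (\<lambda>k. \<Delta> x (1 / Suc k)) else (SOME D. False))"
    proof (cases "cauchy x")
      case True
      then obtain l where "(f has_real_derivative l) (at x)"
        using diff by blast
      then show ?thesis
        using True DERIV_imp_deriv limI lim0 by metis
    next
      case False
      then show ?thesis
        using diff by (auto simp: deriv_def)
    qed
  qed
  moreover have [measurable]: "Measurable.pred borel cauchy"
    unfolding cauchy_def by (measurable, auto simp: countable_rat)
  ultimately show ?thesis by simp
qed

section \<open>Absolute continuity and the fundamental theorem of calculus\<close>

lemma abs_continuous_on_interval_dist:
  assumes ac: "abs_continuous_on_interval a b f" and "e > 0"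
  obtains d where "d > 0"
    and "\<And>x y. \<lbrakk>a \<le> x; x \<le> y; y \<le> b; y - x < d\<rbrakk> \<Longrightarrow> \<bar>f y - f x\<bar> < e"
proof -
  obtain d where d: "d > 0" and H: "\<And>\<D> T. \<lbrakk>\<D> division_of T; T \<subseteq> {a..b}; (\<Sum>K\<in>\<D>. Sup K - Inf K) < d\<rbrakk>
      \<Longrightarrow> (\<Sum>K\<in>\<D>. \<bar>f (Sup K) - f (Inf K)\<bar>) < e"
    using ac \<open>e > 0\<close> unfolding abs_continuous_on_interval_def by meson
  have "\<bar>f y - f x\<bar> < e" if "a \<le> x" "x \<le> y" "y \<le> b" "y - x < d" for x y
  proof -
    have "{{x..y}} division_of {x..y}"
      using division_of_self[of x y] that by simp
    from H[OF this] that show ?thesis by simp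
  qed
  with d that show thesis by blast
qed

lemma abs_continuous_imp_continuous:
  assumes ac: "\<And>a b. abs_continuous_on_interval a b f"
  shows "continuous_on UNIV f"
proof (rule continuous_at_imp_continuous_on, rule ballI)
  fix x :: real
  show "isCont f x"
    unfolding continuous_at_eps_delta
  proof (intro allI impI)
    fix e :: real assume "e > 0"
    then obtain d where d: "d > 0"
      "\<And>u v. \<lbrakk>x - 1 \<le> u; u \<le> v; v \<le> x + 1; v - u < d\<rbrakk> \<Longrightarrow> \<bar>f v - f u\<bar> < e"
      using abs_continuous_on_interval_dist[OF ac[of "x - 1" "x + 1"]] by metis
    have "dist (f y) (f x) < e" if "dist y x < min 1 d" for y
      using d(2)[of x y] d(2)[of y x] that by (cases "x \<le> y") (auto simp: dist_real_def abs_minus_commute)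
    then show "\<exists>d>0. \<forall>y. dist y x < d \<longrightarrow> dist (f y) (f x) < e"
      using d(1) by (intro exI[of _ "min 1 d"]) auto
  qed
qed

text \<open>Subintervals tagged in the exceptional null set lie in an open set of small measure, where
  absolute continuity controls the increments of \<open>f\<close>; on the others \<open>f\<close> is differentiable at the tag.\<close>

lemma fundamental_theorem_of_calculus_abs_continuous:
  fixes f f' :: "real \<Rightarrow> real"
  assumes ac: "abs_continuous_on_interval a b f" and "a \<le> b"
    and ae: "AE x in lborel. (f has_real_derivative f' x) (at x)"
  shows "(f' has_integral (f b - f a)) {a..b}"
proof -
  obtain N where N: "N \<in> null_sets lborel"
    and deriv: "\<And>x. x \<notin> N \<Longrightarrow> (f has_real_derivative f' x) (at x)"
    using ae by (auto elim!: AE_E3)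
  have neg: "negligible N"
    using N by (simp add: negligible_iff_null_sets null_sets_completionI)
  \<comment> \<open>With the integrand reset to 0 on the null set, a piece tagged there contributes
    only its increment of \<open>f\<close> to the error.\<close>
  define g where "g x = (if x \<in> N then 0 else f' x)" for x
  have "(g has_integral (f b - f a)) (cbox a b)"
    unfolding has_integral
  proof (intro allI impI)
    fix e :: real assume "e > 0"
    \<comment> \<open>The \<open>+ 1\<close> keeps the denominator positive when
      \<open>a = b\<close>.\<close>
    define e1 where "e1 = e / (2 * (b - a + 1))"
    have "e1 > 0" using \<open>e > 0\<close> \<open>a \<le> b\<close> by (simp add: e1_def)
    obtain \<delta> where "\<delta> > 0" and \<delta>: "\<And>\<D> T. \<lbrakk>\<D> division_of T; T \<subseteq> {a..b}; (\<Sum>K\<in>\<D>. Sup K - Inf K) < \<delta>\<rbrakk>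
        \<Longrightarrow> (\<Sum>K\<in>\<D>. \<bar>f (Sup K) - f (Inf K)\<bar>) < e / 2"
      using ac \<open>e > 0\<close> unfolding abs_continuous_on_interval_def by (meson half_gt_zero)
    obtain U where U: "open U" "N \<subseteq> U" and "emeasure lborel (U - N) < \<delta>"
      using outer_regular_lborel[of N \<delta>] N \<open>\<delta> > 0\<close>
      by (metis null_setsD2 sets_lborel)
    then have mU: "emeasure lborel U < \<delta>"
      using N by (simp add: emeasure_Diff_null_set)
    \<comment> \<open>Radii for the gauge: at points of \<open>N\<close> small enough to stay in
      \<open>U\<close>, elsewhere small enough for linear approximation with relative error
      \<open>e1\<close>.\<close>
    have "\<exists>d>0. if x \<in> N then ball x d \<subseteq> U else
        (\<forall>y. \<bar>y - x\<bar> < d \<longrightarrow> \<bar>f y - f x - f' x * (y - x)\<bar> \<le> e1 * \<bar>y - x\<bar>)" for x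
    proof (cases "x \<in> N")
      case True
      then show ?thesis using U by (auto simp: open_contains_ball)
    next
      case False
      then show ?thesis
        using deriv[OF False] \<open>e1 > 0\<close>
        unfolding has_field_derivative_def has_derivative_at_alt by (auto simp: mult.commute)
    qed
    then obtain d where d0: "\<And>x. d x > 0" and dN: "\<And>x. x \<in> N \<Longrightarrow> ball x (d x) \<subseteq> U"
      and d: "\<And>x y. \<lbrakk>x \<notin> N; \<bar>y - x\<bar> < d x\<rbrakk> \<Longrightarrow> \<bar>f y - f x - f' x * (y - x)\<bar> \<le> e1 * \<bar>y - x\<bar>"
      by (metis (full_types))
    show "\<exists>\<gamma>. gauge \<gamma> \<and> (\<forall>\<D>. \<D> tagged_division_of cbox a b \<and> \<gamma> fine \<D> \<longrightarrow>
        norm ((\<Sum>(x, K)\<in>\<D>. measure lborel K *\<^sub>R g x) - (f b - f a)) < e)"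
    proof (intro exI conjI allI impI)
      show "gauge (\<lambda>x. ball x (d x))"
        using d0 gauge_ball_dependent by blast
    next
      fix p assume "p tagged_division_of cbox a b \<and> (\<lambda>x. ball x (d x)) fine p"
      then have p: "p tagged_division_of cbox a b" and fine: "(\<lambda>x. ball x (d x)) fine p"
        by auto
      have "finite p" using p by blast
      have K: "\<exists>u v. K = {u..v} \<and> u \<le> x \<and> x \<le> v \<and> a \<le> u \<and> v \<le> b \<and> {u..v} \<subseteq> ball x (d x)"
        if xK: "(x, K) \<in> p" for x K
      proof -
        obtain u v where "K = cbox u v" using tagged_division_ofD(4)[OF p xK] by blast
        with tagged_division_ofD(2,3)[OF p xK] fine xK show ?thesis
          by (intro exI[of _ u] exI[of _ v]) (auto simp: fine_def)
      qed
      define p1 where "p1 = {z \<in> p. fst z \<in> N}"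
      define p2 where "p2 = {z \<in> p. fst z \<notin> N}"
      have p12: "p = p1 \<union> p2" "p1 \<inter> p2 = {}" "finite p1" "finite p2" "p1 \<subseteq> p" "p2 \<subseteq> p"
        using \<open>finite p\<close> by (auto simp: p1_def p2_def)
      \<comment> \<open>The error of a single piece; the increments of \<open>f\<close> telescope to
        \<open>f b - f a\<close>.\<close>
      define h where "h = (\<lambda>(x, K). measure lborel K *\<^sub>R g x - (f (Sup K) - f (Inf K)))"
      have sums: "b - a = (\<Sum>(x,K)\<in>p. Sup K - Inf K)" "f b - f a = (\<Sum>(x,K)\<in>p. f (Sup K) - f (Inf K))"
        using additive_tagged_division_1[where f = "\<lambda>x. x"] additive_tagged_division_1[where f = f]
          \<open>a \<le> b\<close> p by auto
      have pp1: "p1 tagged_partial_division_of cbox a b"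
        using p[unfolded tagged_division_of_def] p12(5) by (blast intro: tagged_partial_division_subset)
      have div: "(snd ` p1) division_of \<Union>(snd ` p1)"
        by (rule partial_division_of_tagged_division[OF pp1])
      have "\<bar>\<Sum>z\<in>p1. h z\<bar> < e / 2"
      proof -
        \<comment> \<open>The pieces overlap only in negligible sets, so their total length is the
          measure of their union, which lies in \<open>U\<close>.\<close>
        have "(\<Sum>K\<in>snd ` p1. Sup K - Inf K) = (\<Sum>K\<in>snd ` p1. measure lborel K)"
        proof (rule sum.cong[OF refl])
          fix L assume "L \<in> snd ` p1"
          then obtain x where "(x, L) \<in> p" using p12(5) by force
          from K[OF this] show "Sup L - Inf L = measure lborel L" by auto
        qed
        also have "\<dots> = (\<Sum>K\<in>snd ` p1. measure lebesgue K)"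
          using division_ofD(4)[OF div] by (intro sum.cong) (fastforce simp: measure_completion)+
        also have "\<dots> = measure lebesgue (\<Union>(snd ` p1))"
        proof -
          have "S \<in> lmeasurable" if "S \<in> snd ` p1" for S
            using division_ofD(4)[OF div that] by auto
          moreover have "pairwise (\<lambda>S T. negligible (S \<inter> T)) (snd ` p1)"
          proof (rule pairwiseI)
            fix S T assume ST: "S \<in> snd ` p1" "T \<in> snd ` p1" "S \<noteq> T"
            have "convex (S \<inter> T)"
              using division_ofD(4)[OF div] ST by (metis convex_Int convex_box(1))
            then show "negligible (S \<inter> T)"
              using division_ofD(5)[OF div] ST by (simp add: negligible_convex_interior)
          qed
          ultimately show ?thesis
            using p12(3) by (intro measure_negligible_finite_Union[symmetric]) auto
        qed
        also have "\<dots> < \<delta>"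
        proof -
          have sub: "\<Union>(snd ` p1) \<subseteq> U"
          proof
            fix y assume "y \<in> \<Union>(snd ` p1)"
            then obtain x L where "y \<in> L" "(x, L) \<in> p1" by force
            then have "(x, L) \<in> p" "x \<in> N" by (auto simp: p1_def)
            from K[OF this(1)] dN[OF this(2)] \<open>y \<in> L\<close> show "y \<in> U" by auto
          qed
          have "emeasure lebesgue U < \<delta>"
            using mU U(1) by (simp add: borel_open)
          moreover have "emeasure lebesgue (\<Union>(snd ` p1)) \<le> emeasure lebesgue U"
            using sub U(1) by (intro emeasure_mono) (auto simp: borel_open)
          ultimately have "emeasure lebesgue (\<Union>(snd ` p1)) < \<delta>"
            by simp
          then show ?thesis
            by (cases "emeasure lebesgue (\<Union>(snd ` p1))") (auto simp: measure_def ennreal_less_iff)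
        qed
        finally have "(\<Sum>K\<in>snd ` p1. \<bar>f (Sup K) - f (Inf K)\<bar>) < e / 2"
          using p12(5) by (intro \<delta>[OF div]) (force dest!: K)+
        \<comment> \<open>The exception for the empty set avoids the junk values \<open>Sup {}\<close> and \<open>Inf {}\<close>.\<close>
        define w where "w L = (if L = {} then 0 else \<bar>f (Sup L) - f (Inf L)\<bar>)" for L
        have "\<bar>\<Sum>z\<in>p1. h z\<bar> \<le> (\<Sum>(x, L)\<in>p1. w L)"
        proof (rule sum_abs[THEN order_trans], rule sum_mono, clarify)
          fix x L assume "(x, L) \<in> p1"
          then have "(x, L) \<in> p" "x \<in> N" by (auto simp: p1_def)
          with K[OF this(1)] show "\<bar>h (x, L)\<bar> \<le> w L"
            by (auto simp: h_def w_def g_def)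
        qed
        \<comment> \<open>An interval shared by two tagged pairs has empty interior, where
          \<open>w\<close> is 0, so the sum over pairs equals the sum over intervals.\<close>
        also have "\<dots> = (\<Sum>L\<in>snd ` p1. w L)"
          by (rule sum.over_tagged_division_lemma[OF tagged_partial_division_of_Union_self[OF pp1]])
             (auto simp: w_def)
        also have "\<dots> \<le> (\<Sum>K\<in>snd ` p1. \<bar>f (Sup K) - f (Inf K)\<bar>)"
          by (rule sum_mono) (auto simp: w_def)
        finally show ?thesis using \<open>_ < e / 2\<close> by linarith
      qed
      moreover have "\<bar>\<Sum>z\<in>p2. h z\<bar> \<le> e1 * (b - a)"
      proof -
        have "\<bar>\<Sum>z\<in>p2. h z\<bar> \<le> (\<Sum>(x, K)\<in>p2. e1 * (Sup K - Inf K))"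
        proof (rule sum_abs[THEN order_trans], rule sum_mono, clarify)
          fix x L assume "(x, L) \<in> p2"
          then have "(x, L) \<in> p" "x \<notin> N" by (auto simp: p2_def)
          obtain u v where L: "L = {u..v}" "u \<le> x" "x \<le> v" "{u..v} \<subseteq> ball x (d x)"
            using K[OF \<open>(x, L) \<in> p\<close>] by blast
          then have "\<bar>u - x\<bar> < d x" "\<bar>v - x\<bar> < d x"
            using subsetD[OF L(4), of u] subsetD[OF L(4), of v]
            by (auto simp: dist_real_def abs_minus_commute)
          then have "\<bar>f u - f x - f' x * (u - x)\<bar> \<le> e1 * (x - u)"
            "\<bar>f v - f x - f' x * (v - x)\<bar> \<le> e1 * (v - x)"
            using d[OF \<open>x \<notin> N\<close>, of u] d[OF \<open>x \<notin> N\<close>, of v] L by auto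
          \<comment> \<open>The estimates on both sides of the tag add up because
            \<open>u \<le> x \<le> v\<close>.\<close>
          then have "\<bar>(v - u) * f' x - (f v - f u)\<bar> \<le> e1 * (v - u)"
            by (simp add: algebra_simps abs_le_iff)
          then show "\<bar>h (x, L)\<bar> \<le> e1 * (Sup L - Inf L)"
            using L \<open>x \<notin> N\<close> by (simp add: h_def g_def)
        qed
        also have "\<dots> \<le> (\<Sum>(x, K)\<in>p. e1 * (Sup K - Inf K))"
          using \<open>e1 > 0\<close> \<open>finite p\<close> p12(6)
          by (intro sum_mono2) (auto dest!: K)
        also have "\<dots> = e1 * (b - a)"
          unfolding sums by (simp add: sum_distrib_left case_prod_unfold)
        finally show ?thesis .
      qed
      moreover have "e1 * (b - a) \<le> e / 2"
        using \<open>e > 0\<close> \<open>a \<le> b\<close> by (simp add: e1_def field_simps)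
      moreover have "(\<Sum>(x, K)\<in>p. measure lborel K *\<^sub>R g x) - (f b - f a) = (\<Sum>z\<in>p. h z)"
        unfolding sums h_def by (simp add: sum_subtractf case_prod_unfold)
      moreover have "(\<Sum>z\<in>p. h z) = (\<Sum>z\<in>p1. h z) + (\<Sum>z\<in>p2. h z)"
        using p12 by (simp add: sum.union_disjoint)
      ultimately show "norm ((\<Sum>(x, K)\<in>p. measure lborel K *\<^sub>R g x) - (f b - f a)) < e"
        by simp
    qed
  qed
  then show ?thesis
    using has_integral_spike_eq[OF neg, of "cbox a b" g f'] by (simp add: g_def)
qed

section \<open>Integrals against monotone scores\<close>

text \<open>Layer cake: \<open>G x\<close> is the integral over \<open>s\<close> of a signed kernel,
  and Fubini reduces the claim to a sign condition for each \<open>s\<close>. For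
  \<open>s < 0\<close> the kernel is the indicator of the upper level set minus 1, and the 1 drops
  out because \<open>\<psi>\<close> has integral 0.\<close>

lemma integral_mult_nonneg_if_upper_level_sets:
  fixes G \<psi> :: "'a \<Rightarrow> real"
  assumes "sigma_finite_measure M"
    and [measurable]: "G \<in> borel_measurable M"
    and \<psi>: "integrable M \<psi>" and G\<psi>: "integrable M (\<lambda>x. G x * \<psi> x)"
    and zero: "(\<integral>x. \<psi> x \<partial>M) = 0"
    and up: "\<And>s. 0 \<le> (\<integral>x. indicator {s<..} (G x) * \<psi> x \<partial>M)"
  shows "0 \<le> (\<integral>x. G x * \<psi> x \<partial>M)"
proof -
  interpret M: sigma_finite_measure M by fact
  interpret pair_sigma_finite M lborel
    by (simp add: pair_sigma_finite_def assms lborel.sigma_finite_measure_axioms)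
  have [measurable]: "\<psi> \<in> borel_measurable M"
    using \<psi> by auto
  \<comment> \<open>The negative branch accounts for points where \<open>G\<close> is negative; the
    positive branch alone would recover only the positive part of \<open>G\<close>.\<close>
  define k :: "'a \<Rightarrow> real \<Rightarrow> real"
    where "k x s = (if 0 \<le> s \<and> s < G x then 1 else if s < 0 \<and> G x \<le> s then -1 else 0)" for x s
  have k_eq: "k x s = indicator {0..<G x} s - indicator {G x..<0} s" for x s
    by (auto simp: k_def indicator_def)
  have k_abs: "\<bar>k x s\<bar> = indicator {0..<G x} s + indicator {G x..<0} s" for x s
    by (auto simp: k_def indicator_def)
  have ind: "integrable lborel (\<lambda>s. indicator {a..<b} s :: real)" for a b :: real
    by (cases "a \<le> b") auto
  have ind_val: "(\<integral>s. indicator {a..<b} s \<partial>lborel) = (max 0 (b - a) :: real)" for a b :: real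
    by (cases "a \<le> b") (auto simp: max_def measure_def)
  have k_int: "integrable lborel (k x)" for x
    unfolding k_eq using ind by auto
  have k_val: "(\<integral>s. k x s \<partial>lborel) = G x" for x
    unfolding k_eq Bochner_Integration.integral_diff[OF ind ind] ind_val by simp
  have k_abs_val: "(\<integral>s. \<bar>k x s\<bar> \<partial>lborel) = \<bar>G x\<bar>" for x
    unfolding k_abs Bochner_Integration.integral_add[OF ind ind] ind_val by simp
  have [measurable]: "(\<lambda>(x, s). k x s) \<in> borel_measurable (M \<Otimes>\<^sub>M lborel)"
    unfolding k_def by measurable
  \<comment> \<open>Absolute integrability: integrating \<open>\<bar>k x s\<bar>\<close> over
    \<open>s\<close> gives \<open>\<bar>G x\<bar>\<close>, and the product of \<open>G\<close> and
    \<open>\<psi>\<close> is integrable.\<close>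
  have int: "integrable (M \<Otimes>\<^sub>M lborel) (\<lambda>(x, s). k x s * \<psi> x)"
  proof (rule Fubini_integrable)
    show "integrable M (\<lambda>x. \<integral>s. norm (case (x, s) of (x, s) \<Rightarrow> k x s * \<psi> x) \<partial>lborel)"
      using integrable_norm[OF G\<psi>] by (simp add: abs_mult k_abs_val)
    show "AE x in M. integrable lborel (\<lambda>s. case (x, s) of (x, s) \<Rightarrow> k x s * \<psi> x)"
      using k_int by simp
  qed measurable
  have "(\<integral>x. G x * \<psi> x \<partial>M) = (\<integral>x. (\<integral>s. k x s * \<psi> x \<partial>lborel) \<partial>M)"
    by (simp add: k_val)
  also have "\<dots> = (\<integral>s. (\<integral>x. k x s * \<psi> x \<partial>M) \<partial>lborel)"
    using Fubini_integral[OF int] by simp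
  also have "\<dots> \<ge> 0"
  proof (rule integral_nonneg_AE, rule AE_I2)
    fix s :: real
    have int_up: "integrable M (\<lambda>x. indicator {s<..} (G x) * \<psi> x)"
      by (rule Bochner_Integration.integrable_bound[OF \<psi>]) (auto simp: indicator_def)
    show "0 \<le> (\<integral>x. k x s * \<psi> x \<partial>M)"
    proof (cases "0 \<le> s")
      case True
      then have "k x s = indicator {s<..} (G x)" for x
        by (auto simp: k_def indicator_def)
      with up[of s] show ?thesis by simp
    next
      case False
      then have "k x s * \<psi> x = indicator {s<..} (G x) * \<psi> x - \<psi> x" for x
        by (auto simp: k_def indicator_def)
      with up[of s] show ?thesis
        using int_up \<psi> zero by simp
    qed
  qed
  finally show ?thesis .
qed

lemma integrable_mult_of_square_integrable:
  fixes g h :: "'a \<Rightarrow> real"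
  assumes [measurable]: "g \<in> borel_measurable M" "h \<in> borel_measurable M"
    and "integrable M (\<lambda>x. (g x)\<^sup>2)" "integrable M (\<lambda>x. (h x)\<^sup>2)"
  shows "integrable M (\<lambda>x. g x * h x)"
proof (rule Bochner_Integration.integrable_bound)
  show "integrable M (\<lambda>x. (g x)\<^sup>2 + (h x)\<^sup>2)"
    using assms by simp
  have "\<bar>g x * h x\<bar> \<le> (g x)\<^sup>2 + (h x)\<^sup>2" for x
  proof -
    have "0 \<le> \<bar>g x\<bar> * \<bar>h x\<bar>" by simp
    then show ?thesis
      using sum_squares_bound[of "\<bar>g x\<bar>" "\<bar>h x\<bar>"] unfolding abs_mult power2_abs by linarith
  qed
  then show "AE x in M. norm (g x * h x) \<le> norm ((g x)\<^sup>2 + (h x)\<^sup>2)"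
    by simp
qed measurable

section \<open>The uniform law on the unit interval and monotone integrands\<close>

abbreviation uniform01 :: "real measure" where
  "uniform01 \<equiv> restrict_space lborel {0<..<1}"

lemma prob_space_uniform01: "prob_space uniform01"
  by (auto simp: emeasure_restrict_space space_restrict_space intro!: prob_spaceI)

lemma borel_measurable_uniform01_mono:
  assumes "mono_on {0<..<1} (G :: real \<Rightarrow> real)"
  shows "G \<in> borel_measurable uniform01"
  using borel_measurable_mono_on_fnc[OF assms]
  by (simp cong: measurable_cong_sets add: sets_restrict_space)

lemma integrable_uniform01_iff:
  "integrable uniform01 g \<longleftrightarrow> set_integrable lborel {0<..<1} (g :: real \<Rightarrow> real)"
  by (subst integrable_restrict_space) (auto simp: set_integrable_def)

lemma integral_uniform01_eq:
  "(\<integral>u. g u \<partial>uniform01) = (LBINT u:{0<..<1}. (g u :: real))"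
  by (subst integral_restrict_space) (auto simp: set_lebesgue_integral_def)

text \<open>The threshold is the infimum of \<open>S\<close>. Whether it belongs to \<open>S\<close>
  is left open, since a single point has measure 0.\<close>

lemma up_closed_unit_interval_cases:
  fixes S :: "real set"
  assumes "S \<subseteq> {0<..<1}" and up: "\<And>x y. \<lbrakk>x \<in> S; x \<le> y; y < 1\<rbrakk> \<Longrightarrow> y \<in> S"
  obtains "S = {}" | "S = {0<..<1}"
  | t where "0 < t" "t < 1" "{t<..<1} \<subseteq> S" "S \<subseteq> {t..<1}"
proof (cases "S = {} \<or> S = {0<..<1}")
  case True
  then show thesis using that by blast
next
  case False
  have bdd: "bdd_below S"
    using assms(1) by (auto intro!: bdd_belowI[of _ 0])
  define t where "t = Inf S"
  have 1: "S \<subseteq> {t..<1}"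
    using assms(1) cInf_lower[OF _ bdd] by (auto simp: t_def)
  have 2: "{t<..<1} \<subseteq> S"
  proof
    fix x assume "x \<in> {t<..<1}"
    then obtain y where "y \<in> S" "y < x"
      using cInf_less_iff[of S x] False bdd by (auto simp: t_def)
    then show "x \<in> S" using up \<open>x \<in> _\<close> by auto
  qed
  obtain y where "y \<in> {0<..<1}" "y \<notin> S" using False assms(1) by blast
  then have "y \<le> t" "0 < y" using 2 by force+
  moreover have "t < 1" using 1 False by force
  ultimately show thesis using that(3)[OF _ _ 2 1] by simp
qed

text \<open>Each upper level set of a nondecreasing \<open>G\<close> is empty, the whole unit
  interval, or a tail up to its endpoint. The zero integral and the tail condition therefore give
  the layer cake criterion.\<close>

lemma integral_mono_mult_nonneg_if_tails:
  fixes G \<psi> :: "real \<Rightarrow> real"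
  assumes mono: "mono_on {0<..<1} G"
    and \<psi>: "integrable uniform01 \<psi>" and G\<psi>: "integrable uniform01 (\<lambda>u. G u * \<psi> u)"
    and zero: "(\<integral>u. \<psi> u \<partial>uniform01) = 0"
    and tail: "\<forall>t\<in>{0<..<1}. 0 \<le> (\<integral>u. indicator {t<..} u * \<psi> u \<partial>uniform01)"
  shows "0 \<le> (\<integral>u. G u * \<psi> u \<partial>uniform01)"
proof (rule integral_mult_nonneg_if_upper_level_sets[OF _ borel_measurable_uniform01_mono[OF mono] \<psi> G\<psi> zero])
  show "sigma_finite_measure uniform01"
    using prob_space_uniform01 by (simp add: prob_space_imp_sigma_finite)
  fix s :: real
  define S where "S = {u \<in> {0<..<1}. s < G u}"
  have sp: "space uniform01 = {0<..<1}" by (simp add: space_restrict_space)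
  have up: "S \<subseteq> {0<..<1}" "\<And>x y. \<lbrakk>x \<in> S; x \<le> y; y < 1\<rbrakk> \<Longrightarrow> y \<in> S"
    using mono_onD[OF mono] by (auto simp: S_def intro: less_le_trans)
  consider "S = {}" | "S = {0<..<1}" | t where "0 < t" "t < 1" "{t<..<1} \<subseteq> S" "S \<subseteq> {t..<1}"
    using up_closed_unit_interval_cases[of S] up by blast
  note cases = this
  have "(\<integral>u. indicator {s<..} (G u) * \<psi> u \<partial>uniform01) = (\<integral>u. indicator S u * \<psi> u \<partial>uniform01)"
    by (rule Bochner_Integration.integral_cong) (auto simp: S_def sp indicator_def)
  also have "\<dots> \<ge> 0"
  proof (cases rule: cases)
    case 2
    then have "(\<integral>u. indicator S u * \<psi> u \<partial>uniform01) = (\<integral>u. \<psi> u \<partial>uniform01)"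
      by (intro Bochner_Integration.integral_cong) (auto simp: sp indicator_def)
    with zero show ?thesis by simp
  next
    case (3 t)
    \<comment> \<open>\<open>S\<close> may contain the threshold \<open>t\<close> itself, so the
      integrands agree only almost everywhere.\<close>
    have "AE u in lborel. u \<in> {0<..<1} \<longrightarrow> indicator S u * \<psi> u = indicator {t<..} u * \<psi> u"
      using AE_lborel_singleton[of t] by eventually_elim (use 3 in \<open>auto simp: indicator_def\<close>)
    then have "AE u in uniform01. indicator S u * \<psi> u = indicator {t<..} u * \<psi> u"
      by (subst AE_restrict_space_iff) auto
    then have "(\<integral>u. indicator S u * \<psi> u \<partial>uniform01) = (\<integral>u. indicator {t<..} u * \<psi> u \<partial>uniform01)"
    proof (intro integral_cong_AE)
      have \<psi>m: "\<psi> \<in> borel_measurable uniform01" using \<psi> by auto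
      have "G \<in> borel_measurable uniform01" by (rule borel_measurable_uniform01_mono[OF mono])
      then have "G -` {s<..} \<inter> space uniform01 \<in> sets uniform01"
        by (rule measurable_sets) simp
      also have "G -` {s<..} \<inter> space uniform01 = S"
        by (auto simp: S_def sp)
      finally have "S \<in> sets uniform01" .
      then show "(\<lambda>u. indicator S u * \<psi> u) \<in> borel_measurable uniform01"
        by (intro borel_measurable_times \<psi>m borel_measurable_indicator)
      show "(\<lambda>u. indicator {t<..} u * \<psi> u) \<in> borel_measurable uniform01"
        by (intro borel_measurable_times \<psi>m measurable_restrict_space1) simp
    qed simp
    with tail 3 show ?thesis by simp
  qed simp
  finally show "0 \<le> (\<integral>u. indicator {s<..} (G u) * \<psi> u \<partial>uniform01)" .
qed

section \<open>Convex scores and their tangent at one half\<close>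

lemma convex_on_right_deriv_le_slope:
  fixes J :: "real \<Rightarrow> real"
  assumes cvx: "convex_on {a..<b} J" and der: "(J has_real_derivative c) (at a)"
    and xy: "a \<le> x" "x < y" "y < b"
  shows "c * (y - x) \<le> J y - J x"
proof -
  have flip: "(p - q) / (r - s) = (q - p) / (s - r)" for p q r s :: real
    by (metis minus_diff_eq minus_divide_divide)
  \<comment> \<open>Slopes of chords from \<open>a\<close> do not increase as the other endpoint
    moves down to \<open>a\<close>, and they tend to \<open>c\<close>.\<close>
  have slope: "(J z - J a) / (z - a) \<ge> c" if z: "a < z" "z < b" for z
  proof (rule tendsto_upperbound)
    show "((\<lambda>t. (J t - J a) / (t - a)) \<longlongrightarrow> c) (at_right a)"
      using der unfolding has_field_derivative_iff
      by (rule filterlim_mono) (auto simp: at_le)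
    show "\<forall>\<^sub>F t in at_right a. (J t - J a) / (t - a) \<le> (J z - J a) / (z - a)"
      unfolding eventually_at_right[OF z(1)]
    proof (intro exI[of _ z] conjI ballI allI impI z)
      fix t assume "a < t" "t < z"
      then show "(J t - J a) / (t - a) \<le> (J z - J a) / (z - a)"
        using convex_on_slope_le(1)[OF cvx, of a z t] z by (simp add: flip[of "J a"])
    qed
  qed simp
  have "c \<le> (J y - J x) / (y - x)"
  proof (cases "x = a")
    case True
    then show ?thesis using slope xy by auto
  next
    case False
    \<comment> \<open>Chords ending at \<open>y\<close> do not get flatter when the left endpoint
      moves from \<open>a\<close> to \<open>x\<close>.\<close>
    have "(J y - J a) / (y - a) \<le> (J y - J x) / (y - x)"
      using convex_on_slope_le(2)[OF cvx, of a y x] xy False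
      by (simp add: flip[of "J a"] flip[of "J x" "J y"])
    then show ?thesis using slope[of y] xy by linarith
  qed
  then show ?thesis using xy by (simp add: pos_le_divide_eq)
qed

text \<open>Reflection at 1/2 carries the left half to the right half, and the halves are joined by
  \<open>G (1/2) = 0\<close>.\<close>

lemma skew_symmetric_score_mono_on:
  assumes skew: "skew_symmetric_score G" and mono: "mono_on {1/2..<1} G"
  shows "mono_on {0<..<1} G"
proof (rule mono_onI)
  fix x y :: real assume xy: "x \<in> {0<..<1}" "y \<in> {0<..<1}" "x \<le> y"
  have refl: "G (1 - u) = - G u" if "u \<in> {0<..<1}" for u
    using skew that by (simp add: skew_symmetric_score_def)
  have half: "G (1/2) = 0" using refl[of "1/2"] by simp
  consider "1/2 \<le> x" | "y \<le> 1/2" | "x < 1/2" "1/2 < y" by linarith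
  then show "G x \<le> G y"
  proof cases
    case 1
    with xy show ?thesis by (auto intro: mono_onD[OF mono])
  next
    case 2
    with xy have "G (1 - y) \<le> G (1 - x)" by (auto intro: mono_onD[OF mono])
    with refl xy show ?thesis by simp
  next
    case 3
    with xy have "G (1/2) \<le> G (1 - x)" "G (1/2) \<le> G y" by (auto intro!: mono_onD[OF mono])
    with refl xy half show ?thesis by simp
  qed
qed

lemma skew_symmetric_wilcoxon: "skew_symmetric_score wilcoxon_score"
  by (simp add: skew_symmetric_score_def wilcoxon_score_def)

text \<open>On the right half every chord of \<open>J\<close> has slope at least \<open>c\<close>,
  so subtracting a line of slope \<open>c\<close> leaves a nondecreasing function; skew symmetry
  covers the left half.\<close>

lemma convex_score_minus_tangent_mono:
  assumes skew: "skew_symmetric_score J" and cvx: "convex_on {1/2..<1} J"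
    and der: "(J has_real_derivative c) (at (1/2))"
  shows "mono_on {0<..<1} (\<lambda>u. J u - c * wilcoxon_score u)"
proof (rule skew_symmetric_score_mono_on)
  show "skew_symmetric_score (\<lambda>u. J u - c * wilcoxon_score u)"
    using skew skew_symmetric_wilcoxon by (simp add: skew_symmetric_score_def)
  show "mono_on {1/2..<1} (\<lambda>u. J u - c * wilcoxon_score u)"
  proof (rule mono_onI)
    fix x y :: real assume "x \<in> {1/2..<1}" "y \<in> {1/2..<1}" "x \<le> y"
    then show "J x - c * wilcoxon_score x \<le> J y - c * wilcoxon_score y"
      using convex_on_right_deriv_le_slope[OF cvx der, of x y]
      by (cases "x = y") (auto simp: wilcoxon_score_def algebra_simps)
  qed
qed

lemma square_integrable_scoreD:
  assumes "square_integrable_score J"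
  shows "J \<in> borel_measurable uniform01" "integrable uniform01 (\<lambda>u. (J u)\<^sup>2)"
  using assms
  by (auto simp: square_integrable_score_def integrable_uniform01_iff set_borel_measurable_def
      borel_measurable_restrict_space_iff)

lemma square_integrable_wilcoxon: "square_integrable_score wilcoxon_score"
proof -
  have "continuous_on {0..1::real} (\<lambda>u. (wilcoxon_score u)\<^sup>2)"
    unfolding wilcoxon_score_def by (intro continuous_intros)
  then have "set_integrable lborel {0..1} (\<lambda>u. (wilcoxon_score u)\<^sup>2)"
    by (rule borel_integrable_atLeastAtMost')
  then have "set_integrable lborel {0<..<1} (\<lambda>u. (wilcoxon_score u)\<^sup>2)"
    by (rule set_integrable_subset) auto
  then show ?thesis
    unfolding square_integrable_score_def by (simp add: set_borel_measurable_def wilcoxon_score_def)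
qed

text \<open>This is the variance of the uniform law on the unit interval.\<close>

lemma K_score_wilcoxon: "K_score wilcoxon_score = 1/12"
proof -
  have "K_score wilcoxon_score = (LBINT u=ereal 0..ereal 1. (u - 1/2)\<^sup>2)"
    by (simp add: K_score_def wilcoxon_score_def interval_lebesgue_integral_def einterval_eq)
  also have "\<dots> = (1 - 1/2)^3 / 3 - (0 - 1/2)^3 / 3"
    by (rule interval_integral_FTC_finite)
       (auto intro!: continuous_intros derivative_eq_intros
          simp: has_real_derivative_iff_has_vector_derivative[symmetric])
  finally show ?thesis by (simp add: power3_eq_cube)
qed

section \<open>Scores integrated against functions with nonnegative tails\<close>

locale regular_score =
  fixes J :: "real \<Rightarrow> real"
  assumes square_integrable: "square_integrable_score J" and mono: "mono_on {0<..<1} J"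
    and skew: "skew_symmetric_score J" and differentiable: "J differentiable_on {0<..<1}"
begin

lemma has_deriv_half: "(J has_real_derivative deriv J (1/2)) (at (1/2))"
proof -
  have "J differentiable (at (1/2) within {0<..<1})"
    using differentiable by (auto simp: differentiable_on_def)
  then show ?thesis
    by (auto simp: at_within_open[of "1/2" "{0<..<1::real}"] DERIV_deriv_iff_real_differentiable)
qed

end

text \<open>Isolates what the location score and the quantile function have in common, so that each
  bound is proved once and instantiated twice.\<close>

locale nonneg_tail_integrals =
  fixes \<psi> :: "real \<Rightarrow> real"
  assumes measurable: "\<psi> \<in> borel_measurable uniform01"
    and square_integrable: "integrable uniform01 (\<lambda>u. (\<psi> u)\<^sup>2)"
    and zero: "(\<integral>u. \<psi> u \<partial>uniform01) = 0"
    and tail: "\<forall>t\<in>{0<..<1}. 0 \<le> (\<integral>u. indicator {t<..} u * \<psi> u \<partial>uniform01)"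
begin

lemma integrable_score_mult:
  assumes "square_integrable_score G"
  shows "integrable uniform01 (\<lambda>u. G u * \<psi> u)"
  using square_integrable_scoreD[OF assms] measurable square_integrable
  by (intro integrable_mult_of_square_integrable) auto

lemma integrable: "integrable uniform01 \<psi>"
proof -
  interpret prob_space uniform01 by (rule prob_space_uniform01)
  show ?thesis using measurable square_integrable by (rule square_integrable_imp_integrable)
qed

lemma integral_mono_nonneg:
  assumes "mono_on {0<..<1} G" and "integrable uniform01 (\<lambda>u. G u * \<psi> u)"
  shows "0 \<le> (\<integral>u. G u * \<psi> u \<partial>uniform01)"
  by (rule integral_mono_mult_nonneg_if_tails[OF assms(1) integrable assms(2) zero tail])

lemma integral_wilcoxon_nonneg: "0 \<le> (\<integral>u. wilcoxon_score u * \<psi> u \<partial>uniform01)"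
  by (rule integral_mono_nonneg)
     (auto simp: wilcoxon_score_def intro: mono_onI integrable_score_mult[OF square_integrable_wilcoxon, unfolded wilcoxon_score_def])

lemma integral_score_nonneg:
  assumes "regular_score J"
  shows "0 \<le> (\<integral>u. J u * \<psi> u \<partial>uniform01)"
proof -
  interpret J: regular_score J by fact
  show ?thesis
    by (rule integral_mono_nonneg[OF J.mono integrable_score_mult[OF J.square_integrable]])
qed

text \<open>By convexity, \<open>J\<close> minus its tangent line at 1/2 is nondecreasing, so its
  integral against \<open>\<psi>\<close> is nonnegative.\<close>

lemma integral_convex_ge:
  assumes "regular_score J" and cvx: "convex_on {1/2..<1} J"
  shows "deriv J (1/2) * (\<integral>u. wilcoxon_score u * \<psi> u \<partial>uniform01) \<le> (\<integral>u. J u * \<psi> u \<partial>uniform01)"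
proof -
  interpret J: regular_score J by fact
  let ?c = "deriv J (1/2)"
  note int = integrable_score_mult[OF J.square_integrable] integrable_score_mult[OF square_integrable_wilcoxon]
  have eq: "(J u - ?c * wilcoxon_score u) * \<psi> u = J u * \<psi> u - ?c * (wilcoxon_score u * \<psi> u)" for u
    by (simp add: algebra_simps)
  have "0 \<le> (\<integral>u. (J u - ?c * wilcoxon_score u) * \<psi> u \<partial>uniform01)"
    using int
    by (intro integral_mono_nonneg convex_score_minus_tangent_mono[OF J.skew cvx J.has_deriv_half])
       (simp add: eq)
  with int show ?thesis by (simp add: eq)
qed

text \<open>The negative of \<open>J\<close> is convex and skew-symmetric, with slope
  \<open>- ?c\<close> at 1/2, so the tangent line minus \<open>J\<close> is nondecreasing.\<close>

lemma integral_concave_le: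
  assumes "regular_score J" and ccv: "concave_on {1/2..<1} J"
  shows "(\<integral>u. J u * \<psi> u \<partial>uniform01) \<le> deriv J (1/2) * (\<integral>u. wilcoxon_score u * \<psi> u \<partial>uniform01)"
proof -
  interpret J: regular_score J by fact
  let ?c = "deriv J (1/2)"
  note int = integrable_score_mult[OF J.square_integrable] integrable_score_mult[OF square_integrable_wilcoxon]
  have eq: "(- J u - (- ?c) * wilcoxon_score u) * \<psi> u = ?c * (wilcoxon_score u * \<psi> u) - J u * \<psi> u" for u
    by (simp add: algebra_simps)
  have "0 \<le> (\<integral>u. (- J u - (- ?c) * wilcoxon_score u) * \<psi> u \<partial>uniform01)"
  proof (rule integral_mono_nonneg[OF convex_score_minus_tangent_mono])
    show "skew_symmetric_score (\<lambda>u. - J u)"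
      using J.skew by (simp add: skew_symmetric_score_def)
    show "convex_on {1/2..<1} (\<lambda>u. - J u)"
      using ccv by (simp add: concave_on_def)
    show "((\<lambda>u. - J u) has_real_derivative - ?c) (at (1/2))"
      by (intro derivative_intros J.has_deriv_half)
    show "integrable uniform01 (\<lambda>u. (- J u - - ?c * wilcoxon_score u) * \<psi> u)"
      unfolding eq using int by simp
  qed
  then show ?thesis unfolding eq using int by simp
qed

end

section \<open>Densities with finite Fisher information\<close>

text \<open>Carries everything about the location score; symmetry and the second moment enter later,
  for the quantile function.\<close>

locale fisher_density =
  fixes f :: "real \<Rightarrow> real"
  assumes class_F0: "f \<in> class_F0"
begin

abbreviation "distribution \<equiv> density lborel (\<lambda>x. ennreal (f x))"

lemma f_nonneg: "0 \<le> f x" and f_integrable: "integrable lborel f" and f_total: "(\<integral>x. f x \<partial>lborel) = 1"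
  using class_F0 by (auto simp: class_F0_def class_F_def prob_density_def has_bochner_integral_iff)

lemma f_abs_continuous: "abs_continuous_on_interval a b f"
  and f_deriv_AE: "AE x in lborel. (f has_real_derivative deriv f x) (at x)"
  and f_at_top: "(f \<longlongrightarrow> 0) at_top" and f_at_bot: "(f \<longlongrightarrow> 0) at_bot"
  and fisher_info: "integrable uniform01 (\<lambda>u. (loc_score f (quantile_fun f u))\<^sup>2)"
  using class_F0 by (auto simp: class_F0_def class_F_def abs_continuous_with_deriv_def
      finite_fisher_info_def integrable_uniform01_iff)

lemma f_continuous: "continuous_on UNIV f"
  by (rule abs_continuous_imp_continuous) (rule f_abs_continuous)

lemma f_measurable [measurable]: "f \<in> borel_measurable borel"
  using f_continuous by (rule borel_measurable_continuous_onI)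

lemma deriv_measurable [measurable]: "deriv f \<in> borel_measurable borel"
  using f_continuous by (rule borel_measurable_deriv_continuous)

lemma loc_score_measurable [measurable]: "loc_score f \<in> borel_measurable borel"
  unfolding loc_score_def by measurable

text \<open>\<open>cdf_distribution\<close> provides the pseudoinverse of the distribution function,
  to which \<open>quantile_fun f\<close> unfolds, with its Galois property and the image of the
  uniform law under it.\<close>

sublocale cdf_distribution distribution
proof -
  have "(\<integral>\<^sup>+ x. ennreal (f x) \<partial>lborel) = 1"
    using f_integrable f_nonneg f_total by (simp add: nn_integral_eq_integral)
  then have "prob_space distribution"
    by (intro prob_spaceI) (simp add: emeasure_density)
  then show "cdf_distribution distribution"
    by (simp add: cdf_distribution_def real_distribution_def real_distribution_axioms_def)
qed

lemma quantile_measurable [measurable]: "quantile_fun f \<in> borel_measurable uniform01"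
  using measurable_CI unfolding quantile_fun_def dist_fun_def
  by (simp cong: measurable_cong_sets add: sets_restrict_space)

section \<open>Change of variables along the quantile function\<close>

lemma distr_quantile: "distr uniform01 borel (quantile_fun f) = distribution"
  using distr_I_eq_M unfolding quantile_fun_def dist_fun_def .

lemma le_dist_fun_iff: "0 < u \<Longrightarrow> u < 1 \<Longrightarrow> u \<le> dist_fun f x \<longleftrightarrow> quantile_fun f u \<le> x"
  using pseudoinverse unfolding quantile_fun_def dist_fun_def .

lemma integrable_quantile_iff:
  assumes [measurable]: "h \<in> borel_measurable borel"
  shows "integrable uniform01 (\<lambda>u. h (quantile_fun f u)) \<longleftrightarrow> integrable lborel (\<lambda>x. f x * (h x :: real))"
proof -
  have "integrable uniform01 (\<lambda>u. h (quantile_fun f u)) \<longleftrightarrow> integrable distribution h"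
    unfolding distr_quantile[symmetric] by (rule integrable_distr_eq[symmetric]) measurable
  also have "\<dots> \<longleftrightarrow> integrable lborel (\<lambda>x. f x * h x)"
    by (subst integrable_density) (auto simp: f_nonneg)
  finally show ?thesis .
qed

lemma integral_quantile:
  assumes [measurable]: "h \<in> borel_measurable borel"
  shows "(\<integral>u. h (quantile_fun f u) \<partial>uniform01) = (\<integral>x. f x * (h x :: real) \<partial>lborel)"
proof -
  have "(\<integral>u. h (quantile_fun f u) \<partial>uniform01) = (\<integral>x. h x \<partial>distribution)"
    unfolding distr_quantile[symmetric] by (rule integral_distr[symmetric]) measurable
  also have "\<dots> = (\<integral>x. f x * h x \<partial>lborel)"
    by (subst integral_density) (auto simp: f_nonneg)
  finally show ?thesis .
qed

text \<open>A law with a density has no atoms, so its distribution function is continuous with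
  limits 0 and 1, and the intermediate value theorem applies.\<close>

lemma dist_fun_attains:
  assumes "0 < t" "t < 1"
  obtains x where "dist_fun f x = t"
proof -
  have "emeasure distribution {x} = 0" for x
  proof -
    have "AE y in lborel. y \<in> {x} \<longrightarrow> ennreal (f y) = 0"
      using AE_lborel_singleton[of x] by eventually_elim simp
    then have "{x} \<in> null_sets distribution"
      by (subst null_sets_density_iff) auto
    then show ?thesis by auto
  qed
  then have "isCont (dist_fun f) x" for x
    unfolding dist_fun_def isCont_cdf by (simp add: measure_def)
  moreover obtain a where "dist_fun f a < t"
    using order_tendstoD(2)[OF bot assms(1)]
    by (metis eventually_happens' trivial_limit_at_bot_linorder dist_fun_def)
  moreover obtain b where "t < dist_fun f b"
    using order_tendstoD(1)[OF top assms(2)]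
    by (metis eventually_happens' trivial_limit_at_top_linorder dist_fun_def)
  moreover have "a \<le> b"
    using mono \<open>dist_fun f a < t\<close> \<open>t < dist_fun f b\<close>
    unfolding dist_fun_def by (meson le_cases monoD not_less order_trans less_imp_le)
  ultimately show thesis
    using IVT[of "dist_fun f" a t b] that by auto
qed

text \<open>For \<open>x\<close> with \<open>dist_fun f x = t\<close>, the Galois property makes
  \<open>t < u\<close> equivalent to \<open>x < quantile_fun f u\<close>, so tails correspond to
  tails. The same \<open>x\<close> serves every \<open>h\<close>.\<close>

lemma integral_above_quantile:
  assumes "0 < t" "t < 1"
  obtains x where "\<And>h. h \<in> borel_measurable borel \<Longrightarrow>
    (\<integral>u. indicator {t<..} u * h (quantile_fun f u) \<partial>uniform01) = (\<integral>y. f y * (indicator {x<..} y * h y) \<partial>lborel)"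
proof -
  obtain x where x: "dist_fun f x = t" using dist_fun_attains[OF assms] .
  have "(\<integral>u. indicator {t<..} u * h (quantile_fun f u) \<partial>uniform01) = (\<integral>y. f y * (indicator {x<..} y * h y) \<partial>lborel)"
    if [measurable]: "h \<in> borel_measurable borel" for h :: "real \<Rightarrow> real"
  proof -
    have "(\<integral>u. indicator {t<..} u * h (quantile_fun f u) \<partial>uniform01) =
        (\<integral>u. indicator {x<..} (quantile_fun f u) * h (quantile_fun f u) \<partial>uniform01)"
    proof (rule Bochner_Integration.integral_cong[OF refl])
      fix u assume "u \<in> space uniform01"
      then have "u \<le> t \<longleftrightarrow> quantile_fun f u \<le> x"
        using le_dist_fun_iff[of u x] x by (simp add: space_restrict_space)
      then show "indicator {t<..} u * h (quantile_fun f u) = indicator {x<..} (quantile_fun f u) * h (quantile_fun f u)"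
        by (auto simp: indicator_def)
    qed
    also have "\<dots> = (\<integral>y. f y * (indicator {x<..} y * h y) \<partial>lborel)"
      by (rule integral_quantile) measurable
    finally show ?thesis .
  qed
  then show thesis by (rule that)
qed

section \<open>Integrals of the location score\<close>

lemma score_times_density_AE: "AE x in lborel. f x * loc_score f x = - deriv f x"
  using f_deriv_AE
proof eventually_elim
  case (elim x)
  show ?case
  proof (cases "f x = 0")
    case True
    \<comment> \<open>A zero of the nonnegative \<open>f\<close> is a minimum, so the derivative
      vanishes there, in agreement with the value 0 that division by zero gives to
      \<open>loc_score f\<close>.\<close>
    have "deriv f x = 0"
      by (rule DERIV_local_min[OF elim, of 1]) (auto simp: True f_nonneg)
    then show ?thesis by (simp add: True)
  qed (simp add: loc_score_def)
qed

lemma score_quantile_measurable: "(\<lambda>u. loc_score f (quantile_fun f u)) \<in> borel_measurable uniform01"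
  by measurable

text \<open>Under a probability measure, finite Fisher information makes the score integrable; the
  change of variables turns the score into \<open>- deriv f\<close>.\<close>

lemma deriv_integrable: "integrable lborel (deriv f)"
proof -
  interpret U: prob_space uniform01 by (rule prob_space_uniform01)
  have "integrable uniform01 (\<lambda>u. loc_score f (quantile_fun f u))"
    using score_quantile_measurable fisher_info by (rule U.square_integrable_imp_integrable)
  then have "integrable lborel (\<lambda>x. f x * loc_score f x)"
    by (simp add: integrable_quantile_iff)
  then have "integrable lborel (\<lambda>x. - deriv f x)"
    by (rule integrable_cong_AE_imp) (measurable, rule score_times_density_AE)
  then show ?thesis by simp
qed

lemma deriv_set_integrable: "A \<in> sets borel \<Longrightarrow> set_integrable lborel A (deriv f)"
  using deriv_integrable unfolding set_integrable_def by (intro integrable_mult_indicator) auto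

lemma integral_deriv_Icc: "a \<le> b \<Longrightarrow> (LBINT x:{a..b}. deriv f x) = f b - f a"
proof -
  assume "a \<le> b"
  have "(deriv f has_integral (f b - f a)) {a..b}"
    by (rule fundamental_theorem_of_calculus_abs_continuous[OF f_abs_continuous \<open>a \<le> b\<close> f_deriv_AE])
  \<comment> \<open>Since \<open>deriv f\<close> is Lebesgue integrable, its gauge integral is the
    Lebesgue integral, and uniqueness identifies the two values.\<close>
  moreover have "(deriv f has_integral (LBINT x:{a..b}. deriv f x)) {a..b}"
    using set_borel_integral_eq_integral[OF deriv_set_integrable[of "{a..b}"]]
    by (simp add: has_integral_iff)
  ultimately show ?thesis by (rule has_integral_unique[rotated])
qed

text \<open>The right endpoint tends to infinity in the fundamental theorem, and \<open>f\<close>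
  vanishes there.\<close>

lemma integral_deriv_Ici: "(LBINT y:{x..}. deriv f y) = - f x"
proof (rule tendsto_unique)
  show "((\<lambda>b. LBINT y:{x..b}. deriv f y) \<longlongrightarrow> (LBINT y:{x..}. deriv f y)) at_top"
    by (rule tendsto_set_lebesgue_integral_at_top) (auto intro: deriv_set_integrable)
  have "((\<lambda>b. f b - f x) \<longlongrightarrow> 0 - f x) at_top"
    by (intro tendsto_intros f_at_top)
  then have "((\<lambda>b. f b - f x) \<longlongrightarrow> - f x) at_top" by simp
  then show "((\<lambda>b. LBINT y:{x..b}. deriv f y) \<longlongrightarrow> - f x) at_top"
    by (rule Lim_transform_eventually)
       (auto simp: integral_deriv_Icc intro!: eventually_at_top_linorderI[of x])
qed simp

text \<open>Split at 0: the left half-line contributes \<open>f 0\<close> and the right one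
  \<open>- f 0\<close>.\<close>

lemma integral_deriv: "(\<integral>y. deriv f y \<partial>lborel) = 0"
proof -
  have "(LBINT y:{..0}. deriv f y) = f 0"
  proof (rule tendsto_unique)
    show "((\<lambda>a. LBINT y:{a..0}. deriv f y) \<longlongrightarrow> (LBINT y:{..0}. deriv f y)) at_bot"
      by (rule tendsto_set_lebesgue_integral_at_bot) (auto intro: deriv_set_integrable)
    have "((\<lambda>a. f 0 - f a) \<longlongrightarrow> f 0 - 0) at_bot"
      by (intro tendsto_intros f_at_bot)
    then have "((\<lambda>a. f 0 - f a) \<longlongrightarrow> f 0) at_bot" by simp
    then show "((\<lambda>a. LBINT y:{a..0}. deriv f y) \<longlongrightarrow> f 0) at_bot"
      by (rule Lim_transform_eventually)
         (auto simp: integral_deriv_Icc intro!: eventually_at_bot_linorderI[of 0])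
  qed simp
  moreover have "(LBINT y:{0<..}. deriv f y) = (LBINT y:{0..}. deriv f y)"
    unfolding set_lebesgue_integral_def
  proof (rule integral_cong_AE)
    show "AE y in lborel. indicator {0<..} y *\<^sub>R deriv f y = indicator {0..} y *\<^sub>R deriv f y"
      using AE_lborel_singleton[of 0] by eventually_elim (auto simp: indicator_def)
  qed measurable
  moreover have "(LBINT y:UNIV. deriv f y) = (LBINT y:{..0} \<union> {0<..}. deriv f y)"
    by (intro arg_cong[where f = "\<lambda>A. LBINT y:A. deriv f y"]) auto
  then have "(LBINT y:UNIV. deriv f y) = (LBINT y:{..0}. deriv f y) + (LBINT y:{0<..}. deriv f y)"
    by (subst (asm) set_integral_Un) (auto intro: deriv_set_integrable)
  ultimately show ?thesis
    using integral_deriv_Ici[of 0] by (simp add: set_lebesgue_integral_def)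
qed

lemma score_integral: "(\<integral>u. loc_score f (quantile_fun f u) \<partial>uniform01) = 0"
proof -
  have "(\<integral>u. loc_score f (quantile_fun f u) \<partial>uniform01) = (\<integral>x. f x * loc_score f x \<partial>lborel)"
    by (rule integral_quantile) measurable
  also have "\<dots> = (\<integral>x. - deriv f x \<partial>lborel)"
    using score_times_density_AE by (intro integral_cong_AE) measurable
  finally show ?thesis using integral_deriv by simp
qed

text \<open>After the change of variables the tail integral is that of \<open>- deriv f\<close>
  beyond some \<open>x\<close>, which equals \<open>f x\<close>.\<close>

lemma score_tail_integral_nonneg:
  "\<forall>t\<in>{0<..<1}. 0 \<le> (\<integral>u. indicator {t<..} u * loc_score f (quantile_fun f u) \<partial>uniform01)"
proof
  fix t :: real assume t: "t \<in> {0<..<1}"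
  obtain x where "\<And>h. h \<in> borel_measurable borel \<Longrightarrow>
    (\<integral>u. indicator {t<..} u * h (quantile_fun f u) \<partial>uniform01) = (\<integral>y. f y * (indicator {x<..} y * h y) \<partial>lborel)"
    using integral_above_quantile[of t] t by auto
  then have "(\<integral>u. indicator {t<..} u * loc_score f (quantile_fun f u) \<partial>uniform01) =
      (\<integral>y. f y * (indicator {x<..} y * loc_score f y) \<partial>lborel)"
    by simp
  also have "\<dots> = (\<integral>y. - (indicator {x..} y * deriv f y) \<partial>lborel)"
  proof (rule integral_cong_AE)
    show "AE y in lborel. f y * (indicator {x<..} y * loc_score f y) = - (indicator {x..} y * deriv f y)"
      using score_times_density_AE AE_lborel_singleton[of x]
      by eventually_elim (auto simp: indicator_def)
  qed measurable
  also have "\<dots> = f x"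
    using integral_deriv_Ici[of x] by (simp add: set_lebesgue_integral_def)
  finally show "0 \<le> (\<integral>u. indicator {t<..} u * loc_score f (quantile_fun f u) \<partial>uniform01)" using f_nonneg by simp
qed

sublocale location: nonneg_tail_integrals "\<lambda>u. loc_score f (quantile_fun f u)"
  using score_quantile_measurable fisher_info score_integral score_tail_integral_nonneg
  by unfold_locales

end

section \<open>The quantile function of a symmetric density\<close>

locale fisher_density_symmetric = fisher_density +
  assumes second_moment: "integrable lborel (\<lambda>x. x\<^sup>2 * f x)" and symmetric: "f (- x) = f x"
begin

lemma quantile_square_integrable: "integrable uniform01 (\<lambda>u. (quantile_fun f u)\<^sup>2)"
  using second_moment by (subst integrable_quantile_iff) (auto simp: mult.commute)

lemma quantile_integral: "(\<integral>u. quantile_fun f u \<partial>uniform01) = 0"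
proof -
  have "(\<integral>u. quantile_fun f u \<partial>uniform01) = (\<integral>x. f x * x \<partial>lborel)"
    by (rule integral_quantile) measurable
  moreover have "(\<integral>x. f x * x \<partial>lborel) = - (\<integral>x. f x * x \<partial>lborel)"
    \<comment> \<open>The reflection of the line at 0 preserves \<open>f\<close> and changes the
      sign of \<open>x\<close>.\<close>
    by (subst lborel_integral_real_affine[where c = "-1" and t = 0]) (simp_all add: symmetric)
  ultimately show ?thesis by simp
qed

lemma quantile_mono: "mono_on {0<..<1} (quantile_fun f)"
  using mono_I unfolding quantile_fun_def dist_fun_def .

text \<open>If the quantile at \<open>t\<close> is nonnegative, monotonicity makes the tail
  integrand nonnegative. Otherwise the part cut off is nonpositive, so the tail integral is at least
  the full integral, which is 0.\<close>

lemma quantile_tail_integral_nonneg: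
  "\<forall>t\<in>{0<..<1}. 0 \<le> (\<integral>u. indicator {t<..} u * quantile_fun f u \<partial>uniform01)"
proof
  fix t :: real assume t: "t \<in> {0<..<1}"
  interpret U: prob_space uniform01 by (rule prob_space_uniform01)
  have int: "integrable uniform01 (quantile_fun f)"
    using quantile_measurable quantile_square_integrable by (rule U.square_integrable_imp_integrable)
  have sp: "space uniform01 = {0<..<1}" by (simp add: space_restrict_space)
  have int_ind: "integrable uniform01 (\<lambda>u. indicator {t<..} u * quantile_fun f u)"
  proof (rule Bochner_Integration.integrable_bound[OF int])
    show "(\<lambda>u. indicator {t<..} u * quantile_fun f u) \<in> borel_measurable uniform01"
      by (intro borel_measurable_times quantile_measurable measurable_restrict_space1) simp
  qed (auto simp: indicator_def)
  show "0 \<le> (\<integral>u. indicator {t<..} u * quantile_fun f u \<partial>uniform01)"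
  proof (cases "0 \<le> quantile_fun f t")
    case True
    show "0 \<le> (\<integral>u. indicator {t<..} u * quantile_fun f u \<partial>uniform01)"
    proof (rule integral_nonneg_AE, rule AE_I2)
      fix u assume "u \<in> space uniform01"
      then show "0 \<le> indicator {t<..} u * quantile_fun f u"
        using True t mono_onD[OF quantile_mono, of t u] by (auto simp: sp indicator_def)
    qed
  next
    case False
    have "(\<integral>u. quantile_fun f u \<partial>uniform01) \<le> (\<integral>u. indicator {t<..} u * quantile_fun f u \<partial>uniform01)"
    proof (rule integral_mono[OF int int_ind])
      fix u assume "u \<in> space uniform01"
      then show "quantile_fun f u \<le> indicator {t<..} u * quantile_fun f u"
        using False t mono_onD[OF quantile_mono, of u t] by (auto simp: sp indicator_def)
    qed
    then show "0 \<le> (\<integral>u. indicator {t<..} u * quantile_fun f u \<partial>uniform01)" by (simp add: quantile_integral)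
  qed
qed

sublocale quantile: nonneg_tail_integrals "quantile_fun f"
  using quantile_measurable quantile_square_integrable quantile_integral
    quantile_tail_integral_nonneg
  by unfold_locales

lemma K_cross_wilcoxon_nonneg: "0 \<le> K_cross wilcoxon_score f"
  and J_cross_wilcoxon_nonneg: "0 \<le> J_cross wilcoxon_score f"
  using location.integral_wilcoxon_nonneg quantile.integral_wilcoxon_nonneg
  unfolding K_cross_def J_cross_def integral_uniform01_eq by blast+

lemma K_cross_nonneg: "regular_score J \<Longrightarrow> 0 \<le> K_cross J f"
  and J_cross_nonneg: "regular_score J \<Longrightarrow> 0 \<le> J_cross J f"
  using location.integral_score_nonneg quantile.integral_score_nonneg
  unfolding K_cross_def J_cross_def integral_uniform01_eq by blast+

lemma cross_convex_ge:
  assumes "regular_score J" and "convex_on {1/2..<1} J"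
  shows "deriv J (1/2) * K_cross wilcoxon_score f \<le> K_cross J f"
    and "deriv J (1/2) * J_cross wilcoxon_score f \<le> J_cross J f"
  using location.integral_convex_ge[OF assms] quantile.integral_convex_ge[OF assms]
  unfolding K_cross_def J_cross_def integral_uniform01_eq by blast+

lemma cross_concave_le:
  assumes "regular_score J" and "concave_on {1/2..<1} J"
  shows "K_cross J f \<le> deriv J (1/2) * K_cross wilcoxon_score f"
    and "J_cross J f \<le> deriv J (1/2) * J_cross wilcoxon_score f"
  using location.integral_concave_le[OF assms] quantile.integral_concave_le[OF assms]
  unfolding K_cross_def J_cross_def integral_uniform01_eq by blast+

end

section \<open>Efficiency bounds\<close>

text \<open>For \<open>b = 0\<close> the quotient is 0 by convention; otherwise the assumptions
  force \<open>b > 0\<close>, and the inequality can be divided and squared.\<close>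

lemma square_ratio_le:
  fixes a b c :: real
  assumes "0 < c" "0 \<le> a" "c * a \<le> b"
  shows "(a / b)\<^sup>2 \<le> 1 / c\<^sup>2"
proof (cases "b = 0")
  case False
  with assms have "b > 0" by (smt (verit) mult_nonneg_nonneg)
  with assms have "a / b \<le> 1 / c" by (simp add: field_simps)
  with assms \<open>b > 0\<close> have "(a / b)\<^sup>2 \<le> (1 / c)\<^sup>2" by (intro power_mono) auto
  then show ?thesis by (simp add: power_divide)
qed simp

text \<open>Serves the concave case, where the Wilcoxon integrals are the denominators; the quotient
  is again 0 if \<open>a = 0\<close>.\<close>

lemma square_ratio_le':
  fixes a b c :: real
  assumes "0 < c" "0 \<le> b" "0 \<le> a" "b \<le> c * a"
  shows "(b / a)\<^sup>2 \<le> c\<^sup>2"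
proof (cases "a = 0")
  case False
  with assms have "b / a \<le> c" by (simp add: field_simps)
  with assms show ?thesis by (intro power_mono) auto
qed simp

lemma K_score_nonneg: "0 \<le> K_score J"
  unfolding K_score_def set_lebesgue_integral_def by (intro integral_nonneg_AE) auto

theorem proposition2p4:
  fixes J1 J2 f :: "real \<Rightarrow> real"
  assumes "square_integrable_score J1" and "square_integrable_score J2"
    and "mono_on {0<..<1} J1" and "mono_on {0<..<1} J2"
    and "skew_symmetric_score J1" and "skew_symmetric_score J2"
    and "J1 differentiable_on {0<..<1}" and "J2 differentiable_on {0<..<1}"
    and "deriv J1 (1/2) > 0" and "deriv J2 (1/2) > 0"
    and "f \<in> class_F2 \<inter> class_FJ J1 \<inter> class_FJ J2"
    and "symmetric_density f"
  shows "(convex_on {1/2..<1} J1 \<and> convex_on {1/2..<1} J2 \<longrightarrow>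
           ARE_SWW_rank f J1 J2 = ARE_Kendall_rank f J1 J2 \<and>
           ARE_Kendall_rank f J1 J2
             \<le> 144 * (K_score J1 * K_score J2 / (deriv J1 (1/2) * deriv J2 (1/2))\<^sup>2)) \<and>
         (concave_on {1/2..<1} J1 \<and> concave_on {1/2..<1} J2 \<longrightarrow>
           ARE_rank_SWW f J1 J2 = ARE_rank_Kendall f J1 J2 \<and>
           ARE_rank_Kendall f J1 J2
             \<le> 1 / 144 * ((deriv J1 (1/2) * deriv J2 (1/2))\<^sup>2 / (K_score J1 * K_score J2)))"
proof -
  \<comment> \<open>The vanishing of \<open>f\<close> at infinity comes from
    \<open>class_FJ\<close>, the second moment from \<open>class_F2\<close>.\<close>
  interpret fisher_density_symmetric f
    using assms(11,12)
    by unfold_locales (auto simp: class_FJ_def class_F2_def symmetric_density_def)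
  have J1: "regular_score J1" and J2: "regular_score J2"
    using assms by (simp_all add: regular_score_def)
  let ?c1 = "deriv J1 (1/2)" and ?c2 = "deriv J2 (1/2)"
  let ?W = wilcoxon_score
  note nonneg = K_score_nonneg[of J1] K_score_nonneg[of J2]
  have "ARE_Kendall_rank f J1 J2 \<le> 144 * (K_score J1 * K_score J2 / (?c1 * ?c2)\<^sup>2)"
    if "convex_on {1/2..<1} J1" "convex_on {1/2..<1} J2"
  proof -
    have "(K_cross ?W f / K_cross J1 f)\<^sup>2 * (J_cross ?W f / J_cross J2 f)\<^sup>2 \<le> (1 / ?c1\<^sup>2) * (1 / ?c2\<^sup>2)"
      using cross_convex_ge[OF J1 that(1)] cross_convex_ge[OF J2 that(2)] assms(9,10)
        K_cross_wilcoxon_nonneg J_cross_wilcoxon_nonneg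
      by (intro mult_mono square_ratio_le) auto
    \<comment> \<open>The factor 144 is the inverse square of
      \<open>K_score wilcoxon_score\<close>.\<close>
    then have "144 * (K_score J1 * K_score J2) * ((K_cross ?W f / K_cross J1 f)\<^sup>2 * (J_cross ?W f / J_cross J2 f)\<^sup>2)
        \<le> 144 * (K_score J1 * K_score J2) * ((1 / ?c1\<^sup>2) * (1 / ?c2\<^sup>2))"
      using nonneg by (intro mult_left_mono) auto
    then show ?thesis
      by (simp add: ARE_Kendall_rank_def K_score_wilcoxon power_mult_distrib mult_ac)
  qed
  moreover have "ARE_rank_SWW f J1 J2 \<le> 1 / 144 * ((?c1 * ?c2)\<^sup>2 / (K_score J1 * K_score J2))"
    if "concave_on {1/2..<1} J1" "concave_on {1/2..<1} J2"
  proof -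
    have "(K_cross J1 f / K_cross ?W f)\<^sup>2 * (J_cross J2 f / J_cross ?W f)\<^sup>2 \<le> ?c1\<^sup>2 * ?c2\<^sup>2"
      using cross_concave_le[OF J1 that(1)] cross_concave_le[OF J2 that(2)] assms(9,10)
        K_cross_wilcoxon_nonneg J_cross_wilcoxon_nonneg K_cross_nonneg[OF J1] J_cross_nonneg[OF J2]
      by (intro mult_mono square_ratio_le') auto
    \<comment> \<open>If a \<open>K_score\<close> is 0, this factor is 0 by the convention for
      division, so nonnegativity of both suffices.\<close>
    then have "(1 / (144 * (K_score J1 * K_score J2))) * ((K_cross J1 f / K_cross ?W f)\<^sup>2 * (J_cross J2 f / J_cross ?W f)\<^sup>2)
        \<le> (1 / (144 * (K_score J1 * K_score J2))) * (?c1\<^sup>2 * ?c2\<^sup>2)"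
      using nonneg by (intro mult_left_mono) auto
    then show ?thesis
      by (simp add: ARE_rank_SWW_def ARE_rank_def K_score_wilcoxon power_mult_distrib mult_ac)
  qed
  moreover have "ARE_SWW_rank f J1 J2 = ARE_Kendall_rank f J1 J2"
    by (simp add: ARE_SWW_rank_def ARE_rank_def ARE_Kendall_rank_def)
  \<comment> \<open>Inversion acts factor by factor, also on vanishing factors because
    \<open>inverse 0 = 0\<close>.\<close>
  moreover have "ARE_rank_SWW f J1 J2 = ARE_rank_Kendall f J1 J2"
    by (simp add: ARE_rank_SWW_def ARE_rank_def ARE_rank_Kendall_def ARE_Kendall_rank_def power_divide)
  ultimately show ?thesis by simp
qed

end
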